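(* Let $G$ and $H$ be simple connected graphs, each with at least two vertices. Then the Kronecker product $G \otimes H$ is not isomorphic to the lexicographic product $G \circ H$.
   Context: All graphs are finite, undirected and simple (no loops or multiple edges). For graphs $G$ and $H$, the following products have vertex set $V(G)\times V(H)$. The Kronecker (direct) product $G\otimes H$: $(x,y)\sim(x',y')$ if $x\sim x'$ in $G$ and $y\sim y'$ in $H$. The lexicographic product $G\circ H$: $(x,y)\sim(x',y')$ if either $x\sim x'$ in $G$, or ($x=x'$ and $y\sim y'$ in $H$). Two graphs are isomorphic if there is a bijection between their vertex sets that preserves adjacency and non-adjacency. *)

theory Defs
  imports "Graph_Theory.Pair_Digraph" "Graph_Theory.Digraph_Component"
    "Graph_Theory.Digraph_Isomorphism"
begin

(* A finite simple graph is a pair_graph: finite, loop-free, with a symmetric arc set, so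
   every undirected edge {u, v} is represented by the two arcs (u, v) and (v, u). *)

definition kronecker_product ::
  "'a pair_pre_digraph \<Rightarrow> 'b pair_pre_digraph \<Rightarrow> ('a \<times> 'b) pair_pre_digraph" where
  "kronecker_product G H = \<lparr>
     pverts = pverts G \<times> pverts H,
     parcs = {((x, y), (x', y')) | x y x' y'.
       (x, x') \<in> parcs G \<and> (y, y') \<in> parcs H} \<rparr>"

definition lexicographic_product ::
  "'a pair_pre_digraph \<Rightarrow> 'b pair_pre_digraph \<Rightarrow> ('a \<times> 'b) pair_pre_digraph" where
  "lexicographic_product G H = \<lparr>
     pverts = pverts G \<times> pverts H,
     parcs = {((x, y), (x', y')) | x y x' y'.
       (x, y) \<in> pverts G \<times> pverts H \<and> (x', y') \<in> pverts G \<times> pverts H \<and>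
       ((x, x') \<in> parcs G \<or> x = x' \<and> (y, y') \<in> parcs H)} \<rparr>"

lemma pair_graph_iff:
  "pair_graph G \<longleftrightarrow> finite (pverts G) \<and> parcs G \<subseteq> pverts G \<times> pverts G \<and>
     (\<forall>u v. (u, v) \<in> parcs G \<longrightarrow> (v, u) \<in> parcs G \<and> u \<noteq> v)" (is "?L \<longleftrightarrow> ?R")
proof
  assume ?L
  then interpret pair_graph G .
  show ?R
    using pair_finite_verts arcs_symmetric no_loops' by (auto dest: in_arcsD1 in_arcsD2)
next
  assume R: ?R
  then have "finite (parcs G)"
    by (meson finite_SigmaI finite_subset)
  with R show ?L
    by unfold_locales (auto simp: symmetric_def sym_def)
qed

lemma pair_graph_kronecker_product:
  assumes "pair_graph G" "pair_graph H"
  shows "pair_graph (kronecker_product G H)"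
  using assms unfolding pair_graph_iff kronecker_product_def by fastforce

lemma pair_graph_lexicographic_product:
  assumes "pair_graph G" "pair_graph H"
  shows "pair_graph (lexicographic_product G H)"
  using assms unfolding pair_graph_iff lexicographic_product_def by fastforce

(* digraph_iso also asks for a map on arcs. On pair graphs this map is determined by the
   vertex map, and digraph_iso is the usual isomorphism of simple graphs. *)
lemma digraph_iso_pair_graph_iff:
  assumes "pair_graph G" "pair_graph H"
  shows "digraph_iso (with_proj G) (with_proj H) \<longleftrightarrow>
    (\<exists>f. bij_betw f (pverts G) (pverts H) \<and>
      (\<forall>u\<in>pverts G. \<forall>v\<in>pverts G. (u, v) \<in> parcs G \<longleftrightarrow> (f u, f v) \<in> parcs H))" (is "?L \<longleftrightarrow> ?R")
proof
  interpret G: pair_graph G by fact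
  assume ?L
  then obtain h where h: "pre_digraph.digraph_isomorphism (with_proj G) h"
    and H: "with_proj H = app_iso h (with_proj G)"
    unfolding digraph_iso_def by blast
  have V: "pverts H = iso_verts h ` pverts G" and A: "parcs H = iso_arcs h ` parcs G"
    and t: "iso_tail h = fst" and s: "iso_head h = snd"
    using H by (simp_all add: with_proj_def app_iso_def)
  have inj: "inj_on (iso_verts h) (pverts G)"
    using G.digraph_isomorphism_inj_on_verts[OF h] by simp
  have arc: "iso_arcs h (u, v) = (iso_verts h u, iso_verts h v)" if "(u, v) \<in> parcs G" for u v
    using G.iso_verts_tail[OF h, of "(u, v)"] G.iso_verts_head[OF h, of "(u, v)"] that t s
    by (simp add: prod_eq_iff)
  show ?R
  proof (intro exI conjI ballI)
    show "bij_betw (iso_verts h) (pverts G) (pverts H)"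
      using inj V by (simp add: bij_betw_def)
    fix u v assume uv: "u \<in> pverts G" "v \<in> pverts G"
    show "(u, v) \<in> parcs G \<longleftrightarrow> (iso_verts h u, iso_verts h v) \<in> parcs H"
    proof
      assume "(u, v) \<in> parcs G"
      then show "(iso_verts h u, iso_verts h v) \<in> parcs H"
        unfolding A by (metis arc imageI)
    next
      assume "(iso_verts h u, iso_verts h v) \<in> parcs H"
      then obtain a b where ab: "(a, b) \<in> parcs G"
        "(iso_verts h u, iso_verts h v) = iso_arcs h (a, b)"
        unfolding A by auto
      then have "iso_verts h u = iso_verts h a" "iso_verts h v = iso_verts h b"
        using arc by auto
      then show "(u, v) \<in> parcs G"
        using inj uv ab(1) by (metis G.in_arcsD1 G.in_arcsD2 inj_onD)
    qed
  qed
next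
  interpret G: pair_graph G by fact
  interpret H: pair_graph H by fact
  assume ?R
  then obtain f where bij: "bij_betw f (pverts G) (pverts H)"
    and adj: "\<And>u v. u \<in> pverts G \<Longrightarrow> v \<in> pverts G \<Longrightarrow>
      (u, v) \<in> parcs G \<longleftrightarrow> (f u, f v) \<in> parcs H" by blast
  let ?h = "\<lparr> iso_verts = f, iso_arcs = map_prod f f, iso_head = snd, iso_tail = fst \<rparr>"
  have inj: "inj_on f (pverts G)" and im: "f ` pverts G = pverts H"
    using bij by (auto simp: bij_betw_def)
  have "inj_on (map_prod f f) (parcs G)"
  proof (rule inj_onI)
    fix e e' assume "e \<in> parcs G" "e' \<in> parcs G" "map_prod f f e = map_prod f f e'"
    then show "e = e'"
      using inj by (cases e; cases e') (auto dest: G.in_arcsD1 G.in_arcsD2 inj_onD)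
  qed
  then have "pre_digraph.digraph_isomorphism (with_proj G) ?h"
    unfolding pre_digraph.digraph_isomorphism_def
    using inj G.wf_digraph by (simp add: map_prod_def split_beta)
  moreover have "parcs H = map_prod f f ` parcs G"
  proof (intro equalityI subsetI)
    fix e assume e: "e \<in> parcs H"
    then obtain u v where "u \<in> pverts G" "v \<in> pverts G" "e = (f u, f v)"
      using im by (metis H.in_arcsD1 H.in_arcsD2 imageE surj_pair)
    then show "e \<in> map_prod f f ` parcs G"
      using e adj by (auto intro!: image_eqI[of _ _ "(u, v)"])
  next
    fix e assume "e \<in> map_prod f f ` parcs G"
    then show "e \<in> parcs H"
      using adj by (auto dest: G.in_arcsD1 G.in_arcsD2)
  qed
  then have "with_proj H = app_iso ?h (with_proj G)"
    using im by (simp add: with_proj_def app_iso_def)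
  ultimately show ?L unfolding digraph_iso_def by blast
qed

end

theory Submission
  imports Defs
begin

text \<open>Both products have the same vertex set and every arc of the Kronecker product is an arc of
  the lexicographic product. The inclusion is strict, because an arc \<open>(x, x')\<close> of \<open>G\<close> gives the
  arc from \<open>(x, y)\<close> to \<open>(x', y)\<close> in the lexicographic product only. Isomorphic graphs have equally
  many arcs.\<close>

text \<open>An isomorphism presents \<open>parcs H\<close> as the image of \<open>parcs G\<close>
  under \<open>iso_arcs h\<close>, and the image of a finite set is no larger than the set.\<close>

lemma card_parcs_le_of_digraph_iso:
  assumes "digraph_iso (with_proj G) (with_proj H)" "finite (parcs G)"
  shows "card (parcs H) \<le> card (parcs G)"
proof -
  obtain h where "with_proj H = app_iso h (with_proj G)"
    using assms(1) unfolding digraph_iso_def by blast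
  then have "parcs H = iso_arcs h ` parcs G"
    by (simp add: with_proj_def app_iso_def)
  with assms(2) show ?thesis
    by (simp add: card_image_le)
qed

text \<open>Connectedness joins two distinct vertices by a walk in the symmetric closure, which has
  arcs only if \<open>G\<close> has.\<close>

lemma connected_parcs_nonempty:
  assumes "connected (with_proj G)" "card (pverts G) \<ge> 2"
  shows "parcs G \<noteq> {}"
proof
  assume empty: "parcs G = {}"
  obtain u v where uv: "u \<in> pverts G" "v \<in> pverts G" "u \<noteq> v"
    using assms(2) by (auto simp: numeral_2_eq_2 card_le_Suc_iff)
  then have "u \<rightarrow>\<^sup>*\<^bsub>with_proj (mk_symmetric G)\<^esub> v"
    using assms(1) by (auto simp: connected_def strongly_connected_def)
  moreover have "parcs (mk_symmetric G) = {}"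
    using empty by (simp add: mk_symmetric_def)
  ultimately show False
    using \<open>u \<noteq> v\<close> by (auto simp: reachable_def elim: rtrancl_on.cases)
qed

lemma kronecker_parcs_psubset_lexicographic:
  assumes "pair_graph G" "pair_graph H" "parcs G \<noteq> {}" "pverts H \<noteq> {}"
  shows "parcs (kronecker_product G H) \<subset> parcs (lexicographic_product G H)"
proof -
  obtain x x' y where xy: "(x, x') \<in> parcs G" "y \<in> pverts H"
    using assms(3,4) by auto
  let ?e = "((x, y), (x', y))"
  \<comment> \<open>As a Kronecker arc, \<open>?e\<close> would require the loop
    \<open>(y, y)\<close> in \<open>H\<close>.\<close>
  have "?e \<in> parcs (lexicographic_product G H)" "?e \<notin> parcs (kronecker_product G H)"
    using assms(1,2) xy
    unfolding pair_graph_iff lexicographic_product_def kronecker_product_def by auto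
  \<comment> \<open>A Kronecker arc already satisfies the first disjunct
    \<open>(x, x') \<in> parcs G\<close>; its endpoints are vertices because arcs of
    \<open>G\<close> and \<open>H\<close> join vertices.\<close>
  moreover have "parcs (kronecker_product G H) \<subseteq> parcs (lexicographic_product G H)"
    using assms(1,2)
    unfolding pair_graph_iff lexicographic_product_def kronecker_product_def by auto
  ultimately show ?thesis by blast
qed

theorem theorem3p7:
  fixes G :: "'a pair_pre_digraph" and H :: "'b pair_pre_digraph"
  assumes "pair_graph G" and "connected (with_proj G)" and "card (pverts G) \<ge> 2"
    and "pair_graph H" and "connected (with_proj H)" and "card (pverts H) \<ge> 2"
  shows "\<not> digraph_iso (with_proj (kronecker_product G H))
                        (with_proj (lexicographic_product G H))"
proof
  assume iso: "digraph_iso (with_proj (kronecker_product G H))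
                           (with_proj (lexicographic_product G H))"
  \<comment> \<open>The two interpretations supply finiteness of both arc sets, on which the two
    cardinality comparisons rest.\<close>
  interpret K: pair_graph "kronecker_product G H"
    using assms(1,4) by (rule pair_graph_kronecker_product)
  interpret L: pair_graph "lexicographic_product G H"
    using assms(1,4) by (rule pair_graph_lexicographic_product)
  have "parcs G \<noteq> {}"
    using assms(2,3) by (rule connected_parcs_nonempty)
  moreover have "pverts H \<noteq> {}"
    using assms(6) by auto
  ultimately have "parcs (kronecker_product G H) \<subset> parcs (lexicographic_product G H)"
    using assms(1,4) by (intro kronecker_parcs_psubset_lexicographic)
  then have "card (parcs (kronecker_product G H)) < card (parcs (lexicographic_product G H))"
    by (simp add: psubset_card_mono)
  with card_parcs_le_of_digraph_iso[OF iso] show False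
    by simp
qed

end
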